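(* For every negative integer $n$ and every integer $k$, $$\binom{n}{k} = \begin{cases} (-1)^k \dbinom{-n+k-1}{k} & \text{if } k\geq 0,\\[2mm] (-1)^{n-k}\dbinom{-k-1}{n-k} & \text{if } k\leq n,\\[2mm] 0 & \text{otherwise.}\end{cases}$$
   Context: The binomial coefficient is defined through the Euler gamma function by $$\binom{x}{y} = \frac{\Gamma(x+1)}{\Gamma(y+1)\,\Gamma(x-y+1)}.$$ A factor $1/\Gamma(m)$ with $m$ a nonpositive integer has the value $0$. For a nonnegative integer first argument $N$ and an integer $j$ this gives $\binom{N}{j}=\frac{N!}{j!(N-j)!}$ if $0\le j\le N$ and $\binom{N}{j}=0$ otherwise; the binomial coefficients on the right-hand side of the claim are of this kind. For a negative integer $n$ and an integer $k$, the numerator $\Gamma(n+1)$ and at least one of the denominator gamma functions $\Gamma(k+1)$, $\Gamma(n-k+1)$ are infinite (their arguments are nonpositive integers). The value of $\binom{n}{k}$ is then understood as follows: the quotient of the infinite numerator gamma function by one infinite denominator gamma function is given its limiting value under a common shift $\delta\to 0$ ($\delta\in\mathbb{C}\setminus\{0\}$) of both arguments, i.e. - if $n-k+1\le 0$ (that is, $k>n$), $$\binom{n}{k}=\frac{1}{\Gamma(k+1)}\,\lim_{\delta\to0}\frac{\Gamma(n+1+\delta)}{\Gamma(n-k+1+\delta)};$$ - if $k+1\le 0$ (that is, $k<0$), $$\binom{n}{k}=\frac{1}{\Gamma(n-k+1)}\,\lim_{\delta\to0}\frac{\Gamma(n+1+\delta)}{\Gamma(k+1+\delta)}.$$ When $n<k<0$,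 all three gamma functions are infinite and both prescriptions apply; the claim is that either one gives the stated value. *)

theory Defs
  imports "HOL-Analysis.Analysis"
begin

text \<open>
  The binomial coefficient \<open>\<Gamma>(x+1) / (\<Gamma>(y+1) \<Gamma>(x-y+1))\<close>. The library function
  \<^const>\<open>rGamma\<close> is the entire function \<open>1/\<Gamma>\<close>, which vanishes at the nonpositive integers.
  This definition is meant only for \<open>x\<close> not a negative integer: there \<open>\<Gamma>(x+1)\<close>
  has a pole, and the library's \<^const>\<open>Gamma\<close> returns the dummy value \<open>0\<close>.
\<close>
definition Gamma_binomial :: "complex \<Rightarrow> complex \<Rightarrow> complex" where
  "Gamma_binomial x y = Gamma (x + 1) * rGamma (y + 1) * rGamma (x - y + 1)"

lemma Gamma_binomial_of_nat:
  "Gamma_binomial (of_nat N) (of_int j) =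
     (if 0 \<le> j \<and> j \<le> int N then of_nat (N choose nat j) else 0)"
proof -
  consider "j < 0" | "j > int N" | "0 \<le> j" "j \<le> int N" by linarith
  then show ?thesis
  proof cases
    case 1
    then have "rGamma (of_int (j + 1) :: complex) = 0"
      by (simp only: rGamma_eq_zero_iff of_int_in_nonpos_Ints_iff)
    then show ?thesis using 1 by (simp add: Gamma_binomial_def)
  next
    case 2
    then have "rGamma (of_int (int N - j + 1) :: complex) = 0"
      by (simp only: rGamma_eq_zero_iff of_int_in_nonpos_Ints_iff)
    then show ?thesis using 2 by (simp add: Gamma_binomial_def)
  next
    case 3
    define m where "m = nat j"
    have j: "j = int m" and m: "m \<le> N" using 3 by (auto simp: m_def)
    have g: "Gamma (of_nat i + 1 :: complex) = fact i" for i
      using Gamma_fact[of i] by (simp add: add.commute)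
    have r: "rGamma (of_nat i + 1 :: complex) = inverse (fact i)" for i
      using g[of i] by (simp add: rGamma_inverse_Gamma)
    have "rGamma (of_nat N - of_nat m + 1 :: complex) = inverse (fact (N - m))"
      using r[of "N - m"] m by (simp add: of_nat_diff)
    then show ?thesis
      using 3 m by (simp add: Gamma_binomial_def j g r binomial_fact divide_simps)
  qed
qed

text \<open>
  For a negative integer \<open>n\<close> the factor \<open>\<Gamma>(n+1)\<close> is infinite. It is paired with an
  infinite denominator factor and the quotient is replaced by its limit under a common shift
  \<open>\<delta>\<close> of both arguments: \<open>\<Gamma>(n-k+1)\<close> in the first relation (applicable if \<open>n < k\<close>),
  \<open>\<Gamma>(k+1)\<close> in the second (applicable if \<open>k < 0\<close>). Both relations include the existence
  of the limit, which then determines \<open>v\<close> uniquely.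
\<close>
definition neg_binomial_pair_diff :: "int \<Rightarrow> int \<Rightarrow> complex \<Rightarrow> bool" where
  "neg_binomial_pair_diff n k v \<longleftrightarrow>
     (\<exists>L. ((\<lambda>\<delta>. Gamma (of_int (n + 1) + \<delta>) / Gamma (of_int (n - k + 1) + \<delta>)) \<longlongrightarrow> L)
            (at (0::complex)) \<and>
          v = rGamma (of_int (k + 1)) * L)"

definition neg_binomial_pair_lower :: "int \<Rightarrow> int \<Rightarrow> complex \<Rightarrow> bool" where
  "neg_binomial_pair_lower n k v \<longleftrightarrow>
     (\<exists>L. ((\<lambda>\<delta>. Gamma (of_int (n + 1) + \<delta>) / Gamma (of_int (k + 1) + \<delta>)) \<longlongrightarrow> L)
            (at (0::complex)) \<and>
          v = rGamma (of_int (n - k + 1)) * L)"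

end

(* Near a pole, the Gamma function behaves like Gamma(-m + d) ~ (-1)^m / (m! d). In the quotient of
   two infinite Gamma functions the factors d cancel, leaving a signed quotient of factorials; the
   remaining factor 1/Gamma either completes it to a binomial coefficient or vanishes. *)
theory Submission
  imports Defs
begin

lemma Gamma_ratio_at_poles:
  "((\<lambda>\<delta>. Gamma (- of_nat p + \<delta>) / Gamma (- of_nat q + \<delta>)) \<longlongrightarrow>
     (-1) ^ (p + q) * fact q / fact p) (at (0::complex))"
proof -
  \<comment> \<open>The residue of Gamma at -m, with the limit recentred by z = -m +
    \<delta>.\<close>
  have residue: "((\<lambda>\<delta>. Gamma (- of_nat m + \<delta>) * \<delta>) \<longlongrightarrow> (-1) ^ m / fact m) (at (0::complex))" for m
    using Gamma_residues[of m, where 'a = complex]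
    by (simp add: LIM_offset_zero_iff[of "- of_nat m"])
  have "((\<lambda>\<delta>. (Gamma (- of_nat p + \<delta>) * \<delta>) / (Gamma (- of_nat q + \<delta>) * \<delta>)) \<longlongrightarrow>
      ((-1) ^ p / fact p) / ((-1) ^ q / fact q)) (at (0::complex))"
    by (intro tendsto_divide residue) auto
  \<comment> \<open>Dividing by (-1)^q is multiplying by it, since its square is 1.\<close>
  also have "((-1) ^ p / fact p) / ((-1) ^ q / fact q) = ((-1) ^ (p + q) * fact q / fact p :: complex)"
    by (simp add: power_add field_simps flip: power_mult_distrib)
  \<comment> \<open>The factors \<delta> cancel wherever \<delta> \<noteq> 0, which is all that a
    punctured limit sees.\<close>
  finally show ?thesis
    by (rule Lim_transform_eventually) (auto simp: eventually_at_filter)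
qed

lemma rGamma_one_plus_of_nat: "rGamma (1 + of_nat m :: complex) = inverse (fact m)"
  using Gamma_fact[of m, where 'a = complex] by (simp add: rGamma_inverse_Gamma)

lemma rGamma_neg_int_plus1: "j < 0 \<Longrightarrow> rGamma (of_int j + 1 :: complex) = 0"
  using rGamma_eq_zero_iff[of "of_int (j + 1) :: complex"] of_int_in_nonpos_Ints_iff[of "j + 1"]
  by simp

text \<open>With n = -p-1 and k = m, the paired arguments n+1 and n-k+1 are the poles -p and -(p+m).
  The limit is (-1)^m (p+m)!/p!, since (-1)^(2p) = 1, and the remaining factor 1/Gamma(k+1) supplies
  1/m!.\<close>

lemma neg_binomial_pair_diff_nonneg:
  "neg_binomial_pair_diff (- int p - 1) (int m) ((-1) ^ m * of_nat ((p + m) choose m))"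
  unfolding neg_binomial_pair_diff_def
proof (intro exI conjI)
  show "((\<lambda>\<delta>. Gamma (of_int (- int p - 1 + 1) + \<delta>) / Gamma (of_int (- int p - 1 - int m + 1) + \<delta>))
      \<longlongrightarrow> (-1) ^ (p + (p + m)) * fact (p + m) / fact p) (at (0::complex))"
    using Gamma_ratio_at_poles[of p "p + m"] by simp
  show "(-1) ^ m * of_nat ((p + m) choose m) =
      rGamma (of_int (int m + 1)) * ((-1) ^ (p + (p + m)) * fact (p + m) / fact p :: complex)"
    by (simp add: rGamma_one_plus_of_nat binomial_fact power_add field_simps flip: power_mult_distrib)
qed

text \<open>The paired quotient has a finite limit, and k+1 \<le> 0 makes the remaining factor
  1/Gamma(k+1) vanish.\<close>

lemma neg_binomial_pair_diff_neg:
  assumes "n < k" "k < 0"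
  shows "neg_binomial_pair_diff n k 0"
proof -
  define p q where "p = nat (- n - 1)" and "q = nat (k - n - 1)"
  have pq: "n + 1 = - int p" "n - k + 1 = - int q"
    using assms by (auto simp: p_def q_def)
  show ?thesis
    unfolding neg_binomial_pair_diff_def pq
    using Gamma_ratio_at_poles[of p q] rGamma_neg_int_plus1[OF assms(2)] by auto
qed

text \<open>The poles are again -p and -(p+m), the latter now coming from k+1. Since n-k = m, the
  factor 1/m! comes from 1/Gamma(n-k+1).\<close>

lemma neg_binomial_pair_lower_le:
  "neg_binomial_pair_lower (- int p - 1) (- int (p + m) - 1)
     ((-1) ^ m * of_nat ((p + m) choose m))"
  unfolding neg_binomial_pair_lower_def
proof (intro exI conjI)
  show "((\<lambda>\<delta>. Gamma (of_int (- int p - 1 + 1) + \<delta>) / Gamma (of_int (- int (p + m) - 1 + 1) + \<delta>))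
      \<longlongrightarrow> (-1) ^ (p + (p + m)) * fact (p + m) / fact p) (at (0::complex))"
    using Gamma_ratio_at_poles[of p "p + m"] by simp
  show "(-1) ^ m * of_nat ((p + m) choose m) =
      rGamma (of_int (- int p - 1 - (- int (p + m) - 1) + 1)) *
        ((-1) ^ (p + (p + m)) * fact (p + m) / fact p :: complex)"
    by (simp add: rGamma_one_plus_of_nat binomial_fact power_add field_simps flip: power_mult_distrib)
qed

text \<open>Here n-k+1 \<le> 0, so it is 1/Gamma(n-k+1) that annihilates the finite limit.\<close>

lemma neg_binomial_pair_lower_gt:
  assumes "n < k" "k < 0"
  shows "neg_binomial_pair_lower n k 0"
proof -
  define p q where "p = nat (- n - 1)" and "q = nat (- k - 1)"
  have pq: "n + 1 = - int p" "k + 1 = - int q"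
    using assms by (auto simp: p_def q_def)
  show ?thesis
    unfolding neg_binomial_pair_lower_def pq
    using Gamma_ratio_at_poles[of p q] rGamma_neg_int_plus1[of "n - k"] assms by auto
qed

theorem theorem2p1:
  fixes n k :: int
  assumes "n < 0"
  shows "let v =
      (if k \<ge> 0 then (-1) powi k * Gamma_binomial (of_int (- n + k - 1)) (of_int k)
       else if k \<le> n then (-1) powi (n - k) * Gamma_binomial (of_int (- k - 1)) (of_int (n - k))
       else 0)
    in (n - k + 1 \<le> 0 \<longrightarrow> neg_binomial_pair_diff n k v) \<and>
       (k + 1 \<le> 0 \<longrightarrow> neg_binomial_pair_lower n k v)"
proof -
  define p where "p = nat (- n - 1)"
  have n: "n = - int p - 1" using assms by (simp add: p_def)
  \<comment> \<open>Serves both nonzero branches: the upper argument is p+m each time, with m = k in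
    the first and m = n-k in the second.\<close>
  have binomial: "Gamma_binomial (of_int (int (p + m))) (of_int (int m)) = of_nat ((p + m) choose m)" for m
    using Gamma_binomial_of_nat[of "p + m" "int m"] by simp
  \<comment> \<open>For k \<ge> 0 only the pairing with Gamma(n-k+1) applies, for k \<le> n only the
    one with Gamma(k+1); strictly in between, both do and must agree on 0.\<close>
  consider "k \<ge> 0" | "k \<le> n" | "n < k" "k < 0" by linarith
  then show ?thesis
  proof cases
    case 1
    define m where "m = nat k"
    have k: "k = int m" using 1 by (simp add: m_def)
    have "- n + k - 1 = int (p + m)" by (simp add: n k)
    then show ?thesis
      using neg_binomial_pair_diff_nonneg[of p m] binomial[of m] by (simp add: Let_def n k)
  next
    case 2
    define m where "m = nat (n - k)"
    have k: "k = - int (p + m) - 1" using 2 by (simp add: m_def n)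
    have "- k - 1 = int (p + m)" "n - k = int m" by (simp_all add: n k)
    then show ?thesis
      using neg_binomial_pair_lower_le[of p m] binomial[of m] 2 assms by (simp add: Let_def n k)
  next
    case 3
    then show ?thesis
      using neg_binomial_pair_diff_neg neg_binomial_pair_lower_gt by (simp add: Let_def)
  qed
qed

end
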